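(* Let $(x^*,y^*,w^* )$ be an equilibrium of the generalized Nash equilibrium problem (GNEP) associated with the data $(F,f,g,X,U)$. Then: (i) $(x^*,y^* )$ is feasible for the standard optimistic bilevel problem (SBP) associated with the same data, that is, $(x^*,y^* )\in W$; (ii) if $g(x,w^* )\le 0$ for all $x$ such that there exists $y$ with $(x,y)\in W$ and $F(x,y)\le F(x^*,y^* )$, then $(x^*,y^* )$ is a global solution of the SBP.
   Context: Data and standing assumptions: $F,f:\mathbb{R}^{n_1}\times\mathbb{R}^{n_2}\to\mathbb{R}$ and $g:\mathbb{R}^{n_1}\times\mathbb{R}^{n_2}\to\mathbb{R}^m$ are continuous; $X\subseteq\mathbb{R}^{n_1}$ and $U\subseteq\mathbb{R}^{n_2}$ are closed. Vector inequalities are componentwise. Let $K(x):=\{v\in\mathbb{R}^{n_2}: g(x,v)\le 0\}$ and let $S(x)$ be the set of global minimizers of $w\mapsto f(x,w)$ over $w\in U\cap K(x)$ (empty if there are none). SBP: minimize $F(x,y)$ over $(x,y)\in W$, where $W:=\{(x,y): x\in X,\ y\in S(x)\}$. A global solution of the SBP is a point $(x^*,y^* )\in W$ with $F(x^*,y^* )\le F(x,y)$ for all $(x,y)\in W$. GNEP: a two-player game in which the leader controls $(x,y)$ and minimizes $F(x,y)$ subject to $(x,y)\in X\times U$, $f(x,y)\le f(x,w)$, $g(x,y)\le 0$, while the follower controls $w$ and minimizes $f(x,w)$ subject to $w\in U$, $g(x,w)\le 0$. For $w\in\mathbb{R}^{n_2}$ put $V(w):=\{(u,v)\in X\times U: f(u,v)\le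 f(u,w),\ g(u,v)\le 0\}$. An equilibrium (solution) of the GNEP is a triple $(x^*,y^*,w^* )$ such that $(x^*,y^* )\in V(w^* )$; $F(x^*,y^* )\le F(x,y)$ for all $(x,y)\in V(w^* )$; $w^*\in U\cap K(x^* )$; and $f(x^*,w^* )\le f(x^*,w)$ for all $w\in U\cap K(x^* )$. *)

theory Defs
  imports "HOL-Analysis.Analysis"
begin

text \<open>
  Throughout, \<open>F\<close>, \<open>f\<close> and \<open>g\<close> take pairs as arguments, and the order on \<open>real ^ 'm\<close> is
  the componentwise one (\<open>less_eq_vec_def\<close>).
\<close>

definition constraint_set ::
  "((real ^ 'n1) \<times> (real ^ 'n2) \<Rightarrow> real ^ 'm) \<Rightarrow> real ^ 'n1 \<Rightarrow> (real ^ 'n2) set" where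
  "constraint_set g x = {v. g (x, v) \<le> 0}"

definition lower_solutions ::
  "((real ^ 'n1) \<times> (real ^ 'n2) \<Rightarrow> real) \<Rightarrow> ((real ^ 'n1) \<times> (real ^ 'n2) \<Rightarrow> real ^ 'm) \<Rightarrow>
   (real ^ 'n2) set \<Rightarrow> real ^ 'n1 \<Rightarrow> (real ^ 'n2) set" where
  "lower_solutions f g U x =
     {y \<in> U \<inter> constraint_set g x. \<forall>w \<in> U \<inter> constraint_set g x. f (x, y) \<le> f (x, w)}"

definition SBP_feasible ::
  "((real ^ 'n1) \<times> (real ^ 'n2) \<Rightarrow> real) \<Rightarrow> ((real ^ 'n1) \<times> (real ^ 'n2) \<Rightarrow> real ^ 'm) \<Rightarrow>
   (real ^ 'n1) set \<Rightarrow> (real ^ 'n2) set \<Rightarrow> ((real ^ 'n1) \<times> (real ^ 'n2)) set" where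
  "SBP_feasible f g X U = {(x, y). x \<in> X \<and> y \<in> lower_solutions f g U x}"

definition SBP_global_solution ::
  "((real ^ 'n1) \<times> (real ^ 'n2) \<Rightarrow> real) \<Rightarrow> ((real ^ 'n1) \<times> (real ^ 'n2) \<Rightarrow> real) \<Rightarrow>
   ((real ^ 'n1) \<times> (real ^ 'n2) \<Rightarrow> real ^ 'm) \<Rightarrow>
   (real ^ 'n1) set \<Rightarrow> (real ^ 'n2) set \<Rightarrow> real ^ 'n1 \<Rightarrow> real ^ 'n2 \<Rightarrow> bool" where
  "SBP_global_solution F f g X U xs ys \<longleftrightarrow>
     (xs, ys) \<in> SBP_feasible f g X U \<and>
     (\<forall>(x, y) \<in> SBP_feasible f g X U. F (xs, ys) \<le> F (x, y))"

definition leader_set ::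
  "((real ^ 'n1) \<times> (real ^ 'n2) \<Rightarrow> real) \<Rightarrow> ((real ^ 'n1) \<times> (real ^ 'n2) \<Rightarrow> real ^ 'm) \<Rightarrow>
   (real ^ 'n1) set \<Rightarrow> (real ^ 'n2) set \<Rightarrow> real ^ 'n2 \<Rightarrow> ((real ^ 'n1) \<times> (real ^ 'n2)) set" where
  "leader_set f g X U w = {(u, v). (u, v) \<in> X \<times> U \<and> f (u, v) \<le> f (u, w) \<and> g (u, v) \<le> 0}"

definition GNEP_equilibrium ::
  "((real ^ 'n1) \<times> (real ^ 'n2) \<Rightarrow> real) \<Rightarrow> ((real ^ 'n1) \<times> (real ^ 'n2) \<Rightarrow> real) \<Rightarrow>
   ((real ^ 'n1) \<times> (real ^ 'n2) \<Rightarrow> real ^ 'm) \<Rightarrow>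
   (real ^ 'n1) set \<Rightarrow> (real ^ 'n2) set \<Rightarrow> real ^ 'n1 \<Rightarrow> real ^ 'n2 \<Rightarrow> real ^ 'n2 \<Rightarrow> bool" where
  "GNEP_equilibrium F f g X U xs ys ws \<longleftrightarrow>
     (xs, ys) \<in> leader_set f g X U ws \<and>
     (\<forall>(x, y) \<in> leader_set f g X U ws. F (xs, ys) \<le> F (x, y)) \<and>
     ws \<in> U \<inter> constraint_set g xs \<and>
     (\<forall>w \<in> U \<inter> constraint_set g xs. f (xs, ws) \<le> f (xs, w))"

end

theory Submission
  imports Defs
begin

text \<open>The follower's \<open>ws\<close> minimizes \<open>f (xs, _)\<close>, and the leader's
  constraint makes \<open>ys\<close> at least as good, so \<open>ys\<close> is a minimizer too. For
  (ii), the leader is optimal only over \<open>leader_set f g X U ws\<close>, which may miss bilevel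
  feasible points. The assumption on \<open>g\<close> places every candidate that could beat
  \<open>(xs, ys)\<close> in this set.\<close>

theorem theorem3p1:
  fixes F f :: "(real ^ 'n1::finite) \<times> (real ^ 'n2::finite) \<Rightarrow> real"
    and g :: "(real ^ 'n1) \<times> (real ^ 'n2) \<Rightarrow> real ^ 'm::finite"
    and X :: "(real ^ 'n1) set" and U :: "(real ^ 'n2) set"
    and xs :: "real ^ 'n1" and ys ws :: "real ^ 'n2"
  assumes "continuous_on UNIV F" and "continuous_on UNIV f" and "continuous_on UNIV g"
    and "closed X" and "closed U"
    and "GNEP_equilibrium F f g X U xs ys ws"
  shows "(xs, ys) \<in> SBP_feasible f g X U \<and>
         ((\<forall>x. (\<exists>y. (x, y) \<in> SBP_feasible f g X U \<and> F (x, y) \<le> F (xs, ys)) \<longrightarrow> g (x, ws) \<le> 0) \<longrightarrow>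
          SBP_global_solution F f g X U xs ys)"
proof (intro conjI impI)
  from assms(6) have leader: "(xs, ys) \<in> leader_set f g X U ws"
    and opt: "\<And>x y. (x, y) \<in> leader_set f g X U ws \<Longrightarrow> F (xs, ys) \<le> F (x, y)"
    and ws: "ws \<in> lower_solutions f g U xs"
    by (auto simp: GNEP_equilibrium_def lower_solutions_def)
  \<comment> \<open>The chain is \<open>f (xs, ys)\<close> \<le> \<open>f (xs, ws)\<close> \<le>
    \<open>f (xs, w)\<close> for each follower-feasible \<open>w\<close>.\<close>
  show feasible: "(xs, ys) \<in> SBP_feasible f g X U"
    using leader ws
    by (auto simp: leader_set_def SBP_feasible_def lower_solutions_def constraint_set_def
        intro: order_trans)
  assume g_ws: "\<forall>x. (\<exists>y. (x, y) \<in> SBP_feasible f g X U \<and> F (x, y) \<le> F (xs, ys)) \<longrightarrow> g (x, ws) \<le> 0"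
  have "F (xs, ys) \<le> F (x, y)" if xy: "(x, y) \<in> SBP_feasible f g X U" for x y
  proof (cases "F (x, y) \<le> F (xs, ys)")
    case True
    with g_ws xy have "g (x, ws) \<le> 0"
      by blast
    \<comment> \<open>Now \<open>ws\<close> is admissible in the lower-level problem at
      \<open>x\<close>, so optimality of \<open>y\<close> there yields \<open>f (x, y)\<close> \<le>
      \<open>f (x, ws)\<close>.\<close>
    with xy ws have "(x, y) \<in> leader_set f g X U ws"
      by (auto simp: leader_set_def SBP_feasible_def lower_solutions_def constraint_set_def)
    then show ?thesis
      by (rule opt)
  qed simp
  with feasible show "SBP_global_solution F f g X U xs ys"
    by (auto simp: SBP_global_solution_def)
qed

end
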